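(* The following statements are true. (1) Let $f,g\in\mathcal S$ be such that $c_f=c_g=c$, $|f'(x)|\ge|g'(x)|$ for all $x\in[0,1]$, $x\neq c$, and $$\frac{|c-a_f|}{|c-a'_f|}\ge\frac{|c-a_g|}{|c-a'_g|}.$$ Then $I_f\supset I_g$. (2) Let $g\in\mathcal S$ be such that $|g'(x)(x-c_g)|\le|g'(x'_g)(x'_g-c_g)|$ for any $x\ge c_g$. Then $I_{\nu g}\supset I_g$ for any $\nu>1$ such that $\nu g$ maps $[0,1]$ into itself.
   Context: **The class $\mathcal S$.** $\mathcal S$ is the set of all convex (meaning concave down) maps $f:[0,1]\to[0,1]$ with a unique turning point $c_f$, which is a maximum (so $f$ is strictly increasing on $[0,c_f]$ and strictly decreasing on $[c_f,1]$), such that $f|_{[0,c_f]}$ and $f|_{[c_f,1]}$ are $C^1$, $f(c_f)>c_f$ and $f(0)=f(1)=0$. (One-sided derivatives at $c_f$ need not vanish or agree; derivative conditions at $c_f$ are understood in terms of one-sided derivatives.) For $f\in\mathcal S$ there is a unique fixed point $a_f\in(c_f,1]$. For $x\ne c_f$, $x'_f$ denotes the unique point $x'_f\ne x$ with $f(x'_f)=f(x)$; also $c'_f=c_f$. We write $a'_f$ for $(a_f)'_f$. **Over-rotation interval.** For a continuous map $f$ of a compact interval into itself put $\chi(x)=1/2$ if $(f(x)-x)(f^2(x)-f(x))\le 0$ and $\chi(x)=0$ otherwise. For a non-fixed periodic point $y$ of (minimal) period $n$ let $l(y)=\sum_{i=0}^{n-1}\chi(f^i(y))$ (an integer); the over-rotation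 number of $y$ is $l(y)/n$. The over-rotation interval $I_f$ is the closure of the set of over-rotation numbers of all non-fixed periodic points of $f$; it is known that if $f$ has a non-fixed periodic point then $I_f=[\rho_f,1/2]$ for some $0\le\rho_f\le 1/2$. (Standing assumption: maps considered have non-fixed periodic points; otherwise $I_f=\emptyset$.) *)

theory Defs
  imports "HOL-Analysis.Analysis"
begin

text \<open>
  Interval maps are total functions on the reals; every notion below depends only on the
  restriction to the interval in question.
\<close>

text \<open>One-sided derivatives at the boundary of \<open>A\<close>.\<close>

definition C1_on :: "real set \<Rightarrow> (real \<Rightarrow> real) \<Rightarrow> bool" where
  "C1_on A f \<longleftrightarrow>
     (\<exists>f'. continuous_on A f' \<and> (\<forall>x\<in>A. (f has_real_derivative f' x) (at x within A)))"

text \<open>There is at most one such \<open>c\<close>, and it is the unique turning point, a maximum.\<close>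

definition is_peak :: "(real \<Rightarrow> real) \<Rightarrow> real \<Rightarrow> bool" where
  "is_peak f c \<longleftrightarrow> c \<in> {0<..<1} \<and> strict_mono_on {0..c} f \<and> strict_antimono_on {c..1} f"

definition class_S :: "(real \<Rightarrow> real) set" where
  "class_S = {f. f ` {0..1} \<subseteq> {0..1} \<and> concave_on {0..1} f \<and> f 0 = 0 \<and> f 1 = 0 \<and>
     (\<exists>c. is_peak f c \<and> C1_on {0..c} f \<and> C1_on {c..1} f \<and> f c > c)}"

definition turning_pt :: "(real \<Rightarrow> real) \<Rightarrow> real" where
  "turning_pt f = (THE c. is_peak f c)"

definition fixed_pt :: "(real \<Rightarrow> real) \<Rightarrow> real" where
  "fixed_pt f = (THE a. a \<in> {turning_pt f<..1} \<and> f a = a)"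

definition twin :: "(real \<Rightarrow> real) \<Rightarrow> real \<Rightarrow> real" where
  "twin f x = (if x = turning_pt f then x
               else THE y. y \<in> {0..1} \<and> y \<noteq> x \<and> f y = f x)"

text \<open>
  The derivative of a map of the unit interval, one-sided at 0 and 1. Its value is unspecified
  at points where the map is not differentiable (for a member of \<open>class_S\<close>, at most at
  the turning point).
\<close>

abbreviation deriv01 :: "(real \<Rightarrow> real) \<Rightarrow> real \<Rightarrow> real" where
  "deriv01 f x \<equiv> vector_derivative f (at x within {0..1})"

definition chi :: "(real \<Rightarrow> real) \<Rightarrow> real \<Rightarrow> real" where
  "chi f x = (if (f x - x) * (f (f x) - f x) \<le> 0 then 1/2 else 0)"

definition has_min_period :: "(real \<Rightarrow> real) \<Rightarrow> real \<Rightarrow> nat \<Rightarrow> bool" where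
  "has_min_period f y n \<longleftrightarrow>
     n > 0 \<and> (f ^^ n) y = y \<and> (\<forall>k. 0 < k \<and> k < n \<longrightarrow> (f ^^ k) y \<noteq> y)"

definition over_rotation_numbers :: "real set \<Rightarrow> (real \<Rightarrow> real) \<Rightarrow> real set" where
  "over_rotation_numbers X f =
     {(\<Sum>i<n. chi f ((f ^^ i) y)) / real n | y n. y \<in> X \<and> f y \<noteq> y \<and> has_min_period f y n}"

text \<open>Empty if \<open>f\<close> has no non-fixed periodic point in \<open>X\<close>.\<close>

definition over_rotation_interval :: "real set \<Rightarrow> (real \<Rightarrow> real) \<Rightarrow> real set" where
  "over_rotation_interval X f = closure (over_rotation_numbers X f)"

end

theory Submission
  imports Defs
begin

text \<open>
  A map \<open>f\<close> in the class moves points up on \<open>(0, a)\<close>, where \<open>a\<close> is the interior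
  fixed point, and sends \<open>(a, 1]\<close> into \<open>[0, a)\<close>. So the over-rotation number of a
  periodic orbit is the frequency of its visits to \<open>(a, 1]\<close>
  (\<open>over_rotation_numbers_eq\<close>). Skipping these visits yields an induced map of
  \<open>[0, a]\<close>: with \<open>b\<close> the twin of \<open>a\<close>, it is \<open>f\<close> on \<open>[0, b]\<close> and
  \<open>f \<circ> f\<close> on \<open>[b, a]\<close>. It behaves like a circle map that winds around once whenever
  the second rule is used, and slow winding means a small over-rotation number.

  The first statement reduces to a comparison of two such induced maps. The dilation about the
  common turning point that matches the fixed points has factor at least 1, and concavity
  makes \<open>f\<close> steeper than \<open>g\<close> even after this dilation. Integrating slopes, starting from
  the fixed point and from its twin, one finds that the increasing branches of the induced map of
  \<open>f\<close> lie below those of \<open>g\<close>; on the left this is where the ratio condition is used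
  (\<open>over_rotation_interval_subset_if_ratio\<close>).

  A lower map winds more slowly, and it remains to exhibit the orbits
  (\<open>over_rotation_interval_subset\<close>). For \<open>0 < p < N\<close> there is a sorted
  sequence of \<open>N\<close> points which the increasing branches of \<open>f\<close> carry into one another like the rotation by \<open>p\<close>,
  except that a target too small to be attained by the second branch is replaced by the least
  attained value (\<open>truncated_orbit\<close>). If no target was replaced, the sequence is an orbit
  of \<open>f\<close> with over-rotation number \<open>p / (N + p)\<close> (\<open>rotation_system_realizes\<close>). Otherwise it is a
  sequence of barriers which the orbits of \<open>g\<close> pass at least as fast as the rotation, so every
  over-rotation number of \<open>g\<close> is at least \<open>p / (N + p)\<close>
  (\<open>truncation_bounds_visits\<close>). Hence if \<open>g\<close> has an orbit of over-rotation number
  \<open>r < 1/2\<close>, then \<open>f\<close> attains all rationals in \<open>(r, 1/2)\<close>, and \<open>r\<close> belongs to the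
  closure. The value \<open>1/2\<close> comes from an orbit of period two (\<open>half_preserved\<close>).

  For the second statement, \<open>\<nu> * g\<close> has the same turning point and the same twins as
  \<open>g\<close>, and its fixed point is farther to the right. The hypothesis on \<open>g\<close> makes the
  ratio of the distances of a point and of its twin from the turning point increase with the point
  (\<open>twin_ratio_mono\<close>), so that the ratio condition of the first statement is satisfied.
\<close>

section \<open>Counting visits along a periodic orbit\<close>

text \<open>
  The natural-number count of visits behind \<open>\<chi>\<close>: along a periodic orbit of a
  unimodal map with interior fixed point \<open>a\<close>, every visit to \<open>(a, 1]\<close> is
  followed by a visit to \<open>[0, a)\<close>, so \<open>\<chi>\<close> collects one half on entering and
  one half on leaving.
\<close>

definition right_visits :: "(real \<Rightarrow> real) \<Rightarrow> real \<Rightarrow> real \<Rightarrow> nat \<Rightarrow> nat" where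
  "right_visits f a y n = (\<Sum>i<n. of_bool (a < (f ^^ i) y))"

lemma right_visits_0 [simp]: "right_visits f a y 0 = 0"
  by (simp add: right_visits_def)

lemma right_visits_Suc [simp]:
  "right_visits f a y (Suc n) = right_visits f a y n + of_bool (a < (f ^^ n) y)"
  by (simp add: right_visits_def)

lemma right_visits_add:
  "right_visits f a y (m + n) = right_visits f a y m + right_visits f a ((f ^^ m) y) n"
proof (induction n)
  case (Suc n)
  have "(f ^^ (m + n)) y = (f ^^ n) ((f ^^ m) y)"
    by (metis add.commute comp_apply funpow_add)
  with Suc show ?case by simp
qed simp

lemma right_visits_mono: "m \<le> n \<Longrightarrow> right_visits f a y m \<le> right_visits f a y n"
  by (metis le_add1 le_add_diff_inverse right_visits_add)

lemma funpow_mult_periodic: "(f ^^ n) y = y \<Longrightarrow> (f ^^ (k * n)) y = y"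
  by (induction k) (simp_all add: funpow_add)

lemma right_visits_periodic:
  "(f ^^ n) y = y \<Longrightarrow> right_visits f a y (k * n) = k * right_visits f a y n"
  by (induction k) (simp_all add: right_visits_add add.commute)

lemma right_visits_shift:
  assumes "(f ^^ n) y = y"
  shows "right_visits f a ((f ^^ m) y) n = right_visits f a y n"
proof -
  have "right_visits f a y (m + n) = right_visits f a y (n + m)"
    by (simp add: add.commute)
  then show ?thesis
    unfolding right_visits_add by (simp add: assms)
qed

text \<open>
  A time that is not a multiple of the period costs at most one more period. This
  suffices where frequencies are compared in the limit: the times supplied by the induction in
  \<open>truncation_bounds_visits\<close> are not chosen as multiples of the period.
\<close>

lemma right_visits_le_proportion:
  assumes "(f ^^ n) y = y" "n > 0"
  shows "n * right_visits f a y t \<le> right_visits f a y n * (t + n)"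
proof -
  have "t \<le> (t div n + 1) * n"
    using dividend_less_div_times[OF \<open>n > 0\<close>, of t] by (simp add: algebra_simps)
  then have "right_visits f a y t \<le> (t div n + 1) * right_visits f a y n"
    using right_visits_mono right_visits_periodic[OF assms(1)] by metis
  then have "n * right_visits f a y t \<le> n * ((t div n + 1) * right_visits f a y n)"
    by (rule mult_le_mono2)
  also have "\<dots> = ((t div n) * n + n) * right_visits f a y n"
    by (simp add: algebra_simps)
  also have "\<dots> \<le> (t + n) * right_visits f a y n"
    by (intro mult_le_mono1 add_le_mono1) simp
  finally show ?thesis by (simp add: mult.commute)
qed

lemma minimal_period_exists:
  assumes "(f ^^ n) y = y" "n > 0"
  obtains d where "has_min_period f y d" "d dvd n"
proof -
  define d where "d = (LEAST k. 0 < k \<and> (f ^^ k) y = y)"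
  have d: "0 < d \<and> (f ^^ d) y = y"
    unfolding d_def by (rule LeastI[of _ n]) (use assms in auto)
  have least: "(f ^^ k) y \<noteq> y" if "0 < k" "k < d" for k
    using not_less_Least[of k "\<lambda>k. 0 < k \<and> (f ^^ k) y = y"] that unfolding d_def by auto
  have "(f ^^ (n mod d)) y = y"
    using d assms by (simp add: funpow_mod_eq)
  then have "n mod d = 0"
    using least[of "n mod d"] d by (metis gr0I mod_less_divisor)
  then have "d dvd n" by auto
  moreover have "has_min_period f y d"
    using d least by (auto simp: has_min_period_def)
  ultimately show ?thesis using that by blast
qed

section \<open>Unimodal maps and their over-rotation numbers\<close>

text \<open>
  What the combinatorial part needs to know about a member of the class. Here \<open>a\<close> is the
  interior fixed point and \<open>b\<close> its twin, so that \<open>(b, a)\<close> is exactly the part of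
  \<open>[0, a)\<close> that is sent to the right of \<open>a\<close>.
\<close>

locale unimodal =
  fixes f :: "real \<Rightarrow> real" and c a b :: real
  assumes order: "0 < b" "b < c" "c < a" "a < 1"
    and maps: "\<And>x. 0 \<le> x \<Longrightarrow> x \<le> 1 \<Longrightarrow> 0 \<le> f x \<and> f x \<le> 1"
    and f0: "f 0 = 0" and fa: "f a = a" and fb: "f b = a"
    and cont: "continuous_on {0..1} f"
    and incr: "strict_mono_on {0..c} f" and decr: "strict_antimono_on {c..1} f"
    and above: "\<And>x. 0 < x \<Longrightarrow> x < a \<Longrightarrow> x < f x"
begin

lemma f_less: "0 \<le> x \<Longrightarrow> x < y \<Longrightarrow> y \<le> c \<Longrightarrow> f x < f y"
  using incr by (auto simp: monotone_on_def)

lemma f_le: "0 \<le> x \<Longrightarrow> x \<le> y \<Longrightarrow> y \<le> c \<Longrightarrow> f x \<le> f y"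
  using f_less[of x y] by (cases "x = y") auto

lemma f_greater: "c \<le> x \<Longrightarrow> x < y \<Longrightarrow> y \<le> 1 \<Longrightarrow> f y < f x"
  using decr by (auto simp: monotone_on_def)

lemma f_ge: "c \<le> x \<Longrightarrow> x \<le> y \<Longrightarrow> y \<le> 1 \<Longrightarrow> f y \<le> f x"
  using f_greater[of x y] by (cases "x = y") auto

lemma right_to_left: "a < x \<Longrightarrow> x \<le> 1 \<Longrightarrow> f x < a"
  using f_greater[of a x] order fa by auto

lemma left_of_b: "0 \<le> x \<Longrightarrow> x < b \<Longrightarrow> f x < a"
  using f_less[of x b] order fb by auto

lemma middle_to_right: "b < x \<Longrightarrow> x < a \<Longrightarrow> a < f x"
  using f_less[of b x] f_greater[of x a] order fa fb by (cases "x \<le> c") auto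

lemma le_peak: "0 \<le> x \<Longrightarrow> x \<le> 1 \<Longrightarrow> f x \<le> f c"
  using f_le[of x c] f_ge[of c x] order by (cases "x \<le> c") auto

lemma peak: "a < f c" "f c \<le> 1"
  using middle_to_right[of c] maps[of c] order by auto

lemma right_image_ge: "a < x \<Longrightarrow> 0 \<le> y \<Longrightarrow> y \<le> 1 \<Longrightarrow> x = f y \<Longrightarrow> f (f c) \<le> f x"
  using f_ge[of x "f c"] le_peak[of y] peak order by auto

lemma fixed_points: "0 \<le> x \<Longrightarrow> x \<le> 1 \<Longrightarrow> f x = x \<longleftrightarrow> x = 0 \<or> x = a"
  using above[of x] right_to_left[of x] f0 fa order
  by (metis less_eq_real_def less_irrefl linorder_neqE_linordered_idom order_less_trans)

lemma ff_less: "c \<le> x \<Longrightarrow> x < y \<Longrightarrow> y \<le> a \<Longrightarrow> f (f x) < f (f y)"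
  using f_greater[of x y] f_ge[of y a] f_greater[of "f y" "f x"] maps[of x] order fa by auto

lemma ff_le: "c \<le> x \<Longrightarrow> x \<le> y \<Longrightarrow> y \<le> a \<Longrightarrow> f (f x) \<le> f (f y)"
  using ff_less[of x y] by (cases "x = y") auto

lemma cont_ff: "continuous_on {0..1} (\<lambda>x. f (f x))"
  by (rule continuous_on_compose2[OF cont cont]) (use maps in auto)

lemma funpow_maps: "0 \<le> x \<Longrightarrow> x \<le> 1 \<Longrightarrow> 0 \<le> (f ^^ k) x \<and> (f ^^ k) x \<le> 1"
  by (induction k) (use maps in auto)

text \<open>
  A periodic orbit that meets a fixed point stays there, hence consists of it.
\<close>

lemma orbit_avoids_fixed_points:
  assumes "0 \<le> y" "y \<le> 1" "(f ^^ n) y = y" "0 < n" "f y \<noteq> y"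
  shows "(f ^^ k) y \<noteq> 0" "(f ^^ k) y \<noteq> a"
proof -
  have "f ((f ^^ k) y) \<noteq> (f ^^ k) y"
  proof
    assume stays: "f ((f ^^ k) y) = (f ^^ k) y"
    have stay: "(f ^^ (j + k)) y = (f ^^ k) y" for j
      by (induction j) (use stays in auto)
    have "k \<le> k * n" using \<open>0 < n\<close> by simp
    then obtain j where j: "k * n = j + k" by (metis le_add_diff_inverse2)
    then have "y = (f ^^ k) y"
      using funpow_mult_periodic[OF assms(3), of k] stay[of j] by simp
    then show False using stays assms(5) by simp
  qed
  then show "(f ^^ k) y \<noteq> 0" "(f ^^ k) y \<noteq> a"
    using f0 fa by auto
qed

lemma sum_chi:
  assumes "0 \<le> y" "y \<le> 1" "(f ^^ n) y = y" "0 < n" "f y \<noteq> y"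
  shows "(\<Sum>i<n. chi f ((f ^^ i) y)) = real (right_visits f a y n)"
proof -
  define v where "v i = (of_bool (a < (f ^^ i) y) :: real)" for i
  have chi: "chi f ((f ^^ i) y) = (v i + v (Suc i)) / 2" for i
  proof -
    define x where "x = (f ^^ i) y"
    have x: "0 < x" "x \<le> 1" "x \<noteq> a"
      using orbit_avoids_fixed_points(1)[OF assms, of i] orbit_avoids_fixed_points(2)[OF assms, of i]
        funpow_maps[OF assms(1,2), of i] by (auto simp: x_def)
    have fx: "0 < f x" "f x \<le> 1" "f x \<noteq> a"
      using orbit_avoids_fixed_points(1)[OF assms, of "Suc i"]
        orbit_avoids_fixed_points(2)[OF assms, of "Suc i"]
        funpow_maps[OF assms(1,2), of "Suc i"] by (auto simp: x_def)
    have sgn: "(y < a \<longrightarrow> 0 < f y - y) \<and> (a < y \<longrightarrow> f y - y < 0)"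
      if "0 < y" "y \<le> 1" for y
      using above[of y] right_to_left[of y] that by auto
    consider "x < a" "f x < a" | "x < a" "a < f x" | "a < x" "f x < a"
      using x fx right_to_left[of x] by linarith
    then have "chi f x = (of_bool (a < x) + of_bool (a < f x)) / 2"
    proof cases
      case 1
      then have "0 < (f x - x) * (f (f x) - f x)"
        using sgn[of x] sgn[of "f x"] x fx by (auto intro: mult_pos_pos)
      then show ?thesis using 1 by (simp add: chi_def)
    next
      case 2
      then have "(f x - x) * (f (f x) - f x) < 0"
        using sgn[of x] sgn[of "f x"] x fx by (auto intro: mult_pos_neg)
      then show ?thesis using 2 by (simp add: chi_def)
    next
      case 3
      then have "(f x - x) * (f (f x) - f x) < 0"
        using sgn[of x] sgn[of "f x"] x fx by (auto intro: mult_neg_pos)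
      then show ?thesis using 3 by (simp add: chi_def)
    qed
    then show ?thesis by (simp add: x_def v_def)
  qed
  have "(\<Sum>i<n. v (Suc i)) = (\<Sum>i<n. v i)"
    using sum.lessThan_Suc_shift[of v n] assms(3) by (simp add: v_def)
  then have "(\<Sum>i<n. chi f ((f ^^ i) y)) = (\<Sum>i<n. v i)"
    by (simp add: chi sum.distrib flip: sum_divide_distrib)
  also have "\<dots> = real (right_visits f a y n)"
    by (simp add: right_visits_def v_def)
  finally show ?thesis .
qed

text \<open>
  The frequency of visits does not change when an orbit is traversed several times, so any
  period serves as well as the minimal one. This lets orbits be constructed from an arbitrary
  fraction, in lowest terms or not.
\<close>

lemma over_rotation_numbers_eq:
  "over_rotation_numbers {0..1} f =
     {real (right_visits f a y n) / real n | y n.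
        0 \<le> y \<and> y \<le> 1 \<and> 0 < n \<and> (f ^^ n) y = y \<and> f y \<noteq> y}" (is "?L = ?R")
proof
  show "?L \<subseteq> ?R"
    using sum_chi by (fastforce simp: over_rotation_numbers_def has_min_period_def)
next
  show "?R \<subseteq> ?L"
  proof
    fix r assume "r \<in> ?R"
    then obtain y n where r: "r = real (right_visits f a y n) / real n"
      and y: "0 \<le> y" "y \<le> 1" "0 < n" "(f ^^ n) y = y" "f y \<noteq> y"
      by auto
    obtain d where d: "has_min_period f y d" "d dvd n"
      using minimal_period_exists[OF y(4,3)] .
    then obtain k where k: "n = k * d" by (metis dvd_def mult.commute)
    have d': "(f ^^ d) y = y" "0 < d" "0 < k"
      using d k y by (auto simp: has_min_period_def)
    have "r = real (right_visits f a y d) / real d"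
      unfolding r k right_visits_periodic[OF d'(1)] using d' by simp
    then show "r \<in> ?L"
      using sum_chi[OF y(1,2) d'(1,2) y(5)] y d
      by (auto simp: over_rotation_numbers_def intro!: exI[of _ y] exI[of _ d])
  qed
qed

lemma consecutive_visits:
  assumes "0 \<le> y" "y \<le> 1"
  shows "of_bool (a < (f ^^ i) y) + of_bool (a < (f ^^ Suc i) y) \<le> (1::nat)"
  using right_to_left[of "(f ^^ i) y"] funpow_maps[OF assms, of i] by auto

text \<open>
  Counting both ends of each step of the orbit; by \<open>consecutive_visits\<close> a step has
  at most one end on the right.
\<close>

lemma twice_visits:
  assumes "(f ^^ n) y = y"
  shows "2 * right_visits f a y n
    = (\<Sum>i<n. of_bool (a < (f ^^ i) y) + of_bool (a < (f ^^ Suc i) y))"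
proof -
  have "right_visits f a (f y) n = (\<Sum>i<n. of_bool (a < (f ^^ Suc i) y))"
    by (simp add: right_visits_def funpow_swap1)
  moreover have "right_visits f a (f y) n = right_visits f a y n"
    using right_visits_shift[OF assms, of a 1] by simp
  ultimately show ?thesis
    by (simp add: sum.distrib right_visits_def)
qed

lemma visits_le_half:
  assumes "0 \<le> y" "y \<le> 1" "(f ^^ n) y = y"
  shows "2 * right_visits f a y n \<le> n"
proof -
  have "2 * right_visits f a y n \<le> (\<Sum>i<n. 1)"
    unfolding twice_visits[OF assms(3)]
    by (intro sum_mono consecutive_visits assms)
  then show ?thesis by simp
qed

lemma alternating_if_half:
  assumes "0 \<le> y" "y \<le> 1" "(f ^^ n) y = y" "2 * right_visits f a y n = n" "i < n"
    and "\<not> a < (f ^^ i) y"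
  shows "a < (f ^^ Suc i) y"
proof (rule ccontr)
  assume *: "\<not> a < (f ^^ Suc i) y"
  have "(\<Sum>i<n. of_bool (a < (f ^^ i) y) + of_bool (a < (f ^^ Suc i) y)) < (\<Sum>i<n. 1::nat)"
    by (rule sum_strict_mono_ex1)
      (use consecutive_visits[OF assms(1,2)] assms(5,6) * in \<open>auto intro!: bexI[of _ i]\<close>)
  then show False
    using twice_visits[OF assms(3)] assms(4) by simp
qed

text \<open>
  To the left of \<open>a\<close> the orbit increases, so a periodic orbit cannot stay there forever.
  The point that follows a visit to the right is at least \<open>f (f c)\<close>, the smallest value
  of \<open>f\<close> on the part \<open>(a, f c]\<close> that orbits can return to.
\<close>

lemma restart_after_right_visit:
  assumes "0 \<le> y" "y \<le> 1" "(f ^^ n) y = y" "0 < n" "f y \<noteq> y"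
  obtains x where "0 < x" "x < a" "(f ^^ n) x = x" "f x \<noteq> x"
    "right_visits f a x n = right_visits f a y n" "f (f c) \<le> x"
proof -
  have "\<exists>i. a < (f ^^ i) y"
  proof (rule ccontr)
    assume none: "\<nexists>i. a < (f ^^ i) y"
    have "(f ^^ i) y < (f ^^ Suc i) y" for i
      using none above[of "(f ^^ i) y"] orbit_avoids_fixed_points(1)[OF assms, of i]
        orbit_avoids_fixed_points(2)[OF assms, of i] funpow_maps[OF assms(1,2), of i]
      by (simp add: linorder_not_less) (metis less_eq_real_def)
    then have "strict_mono (\<lambda>i. (f ^^ i) y)"
      by (simp add: strict_mono_Suc_iff)
    then have "(f ^^ 0) y < (f ^^ n) y"
      using assms(4) by (rule strict_monoD)
    then show False using assms(3) by simp
  qed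
  then obtain i where i: "a < (f ^^ i) y" by auto
  then have "a < (f ^^ (i + n)) y"
    using assms(3) by (simp add: funpow_add)
  then obtain j where j: "a < (f ^^ Suc j) y"
    using assms(4) by (metis Suc_pred add_gr_0)
  define x where "x = (f ^^ Suc (Suc j)) y"
  have "0 < x" "x < a"
    using orbit_avoids_fixed_points(1)[OF assms, of "Suc (Suc j)"]
      funpow_maps[OF assms(1,2), of "Suc j"]
      funpow_maps[OF assms(1,2), of "Suc (Suc j)"] right_to_left[of "(f ^^ Suc j) y"] j
    by (auto simp: x_def)
  moreover have "f (f c) \<le> x"
    using right_image_ge[OF j, of "(f ^^ j) y"] funpow_maps[OF assms(1,2), of j]
    by (simp add: x_def)
  moreover have "(f ^^ n) x = x"
    unfolding x_def by (metis add.commute assms(3) comp_apply funpow_add)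
  moreover have "right_visits f a x n = right_visits f a y n"
    unfolding x_def using right_visits_shift[OF assms(3)] .
  moreover have "f x \<noteq> x"
    using fixed_points[of x] \<open>0 < x\<close> \<open>x < a\<close> order by auto
  ultimately show ?thesis using that by blast
qed

end


section \<open>Orbits that follow a rotation\<close>

text \<open>
  The pattern of a periodic orbit on which a circle map acts as a rotation: \<open>A\<close> and
  \<open>B\<close> are inverse branches, and the branches carry the index \<open>i\<close> to
  \<open>i + p\<close> modulo \<open>N\<close>. Since the range of \<open>A\<close> lies to the left of that of
  \<open>B\<close>, applying the branches preserves sorted sequences, and the Knaster-Tarski
  argument provides a fixed point.
\<close>

lemma monotone_branch_system_fixed_point:
  fixes A B :: "real \<Rightarrow> real" and p N :: nat
  assumes ord: "0 \<le> u" "u \<le> v" "v \<le> a"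
    and monoA: "mono_on {0..a} A" and monoB: "mono_on {0..a} B"
    and rangeA: "A ` {0..a} \<subseteq> {0..u}" and rangeB: "B ` {0..a} \<subseteq> {v..a}"
    and pN: "p \<le> N"
  obtains z where "mono_on {..<N} z"
    and "\<And>i. i < N \<Longrightarrow> z i \<in> {0..a}"
    and "\<And>i. i + p < N \<Longrightarrow> z i = A (z (i + p))"
    and "\<And>i. i < N \<Longrightarrow> N \<le> i + p \<Longrightarrow> z i = B (z (i + p - N))"
proof -
  define \<Phi> where "\<Phi> z i = (if i + p < N then A (z (i + p)) else B (z (i + p - N)))" for z i
  define X where "X = {z. mono_on {..<N} z \<and> (\<forall>i<N. z i \<in> {0..a})}"
  have \<Phi>_X: "\<Phi> z \<in> X" if z: "z \<in> X" for z
  proof -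
    have zr: "z i \<in> {0..a}" if "i < N" for i
      using z that by (auto simp: X_def)
    have zm: "z i \<le> z j" if "i \<le> j" "j < N" for i j
      using z that by (intro mono_onD[of "{..<N}" z]) (auto simp: X_def)
    have rA: "0 \<le> A x \<and> A x \<le> u" and rB: "v \<le> B x \<and> B x \<le> a" if "x \<in> {0..a}" for x
      using rangeA rangeB that by (auto simp: image_subset_iff)
    have "\<Phi> z i \<le> \<Phi> z j" if ij: "i \<le> j" "j < N" for i j
    proof -
      consider "j + p < N" | "i + p < N" "N \<le> j + p" | "N \<le> i + p"
        using ij by linarith
      then show ?thesis
      proof cases
        case 1
        then have "A (z (i + p)) \<le> A (z (j + p))"
          using ij by (intro mono_onD[OF monoA] zr zm) auto
        then show ?thesis using 1 ij by (simp add: \<Phi>_def)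
      next
        case 2
        have "j + p - N < N" using 2 ij pN by linarith
        then have "A (z (i + p)) \<le> B (z (j + p - N))"
          using rA[OF zr[of "i + p"]] rB[OF zr[of "j + p - N"]] 2 ij pN ord by auto
        then show ?thesis using 2 by (simp add: \<Phi>_def)
      next
        case 3
        then have "B (z (i + p - N)) \<le> B (z (j + p - N))"
          using ij pN by (intro mono_onD[OF monoB] zr zm) auto
        then show ?thesis using 3 ij by (simp add: \<Phi>_def)
      qed
    qed
    moreover have "\<Phi> z i \<in> {0..a}" if "i < N" for i
    proof (cases "i + p < N")
      case True
      then show ?thesis using rA[OF zr[of "i + p"]] ord by (auto simp: \<Phi>_def)
    next
      case False
      then have "i + p - N < N" using that pN by linarith
      then show ?thesis
        using rB[OF zr[of "i + p - N"]] False ord by (auto simp: \<Phi>_def)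
    qed
    ultimately show ?thesis by (auto simp: X_def monotone_on_def)
  qed
  have \<Phi>_mono: "\<Phi> y i \<le> \<Phi> z i"
    if "y \<in> X" "z \<in> X" "\<And>j. j < N \<Longrightarrow> y j \<le> z j" "i < N" for y z i
  proof (cases "i + p < N")
    case True
    then have "A (y (i + p)) \<le> A (z (i + p))"
      using that by (intro mono_onD[OF monoA]) (auto simp: X_def)
    then show ?thesis using True by (simp add: \<Phi>_def)
  next
    case False
    then have "B (y (i + p - N)) \<le> B (z (i + p - N))"
      using that pN by (intro mono_onD[OF monoB]) (auto simp: X_def)
    then show ?thesis using False by (simp add: \<Phi>_def)
  qed
  \<comment> \<open>The Knaster-Tarski argument: the supremum of the sequences that lie below their images.\<close>
  define P where "P = {y \<in> X. \<forall>i<N. y i \<le> \<Phi> y i}"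
  have zero: "(\<lambda>_. 0) \<in> P"
  proof -
    have "(\<lambda>_. 0) \<in> X" using ord by (auto simp: X_def monotone_on_def)
    moreover from this have "0 \<le> \<Phi> (\<lambda>_. 0) i" if "i < N" for i
      using \<Phi>_X that unfolding X_def by fastforce
    ultimately show ?thesis by (auto simp: P_def)
  qed
  define z where "z i = (SUP y\<in>P. y i)" for i
  have bdd: "bdd_above ((\<lambda>y. y i) ` P)" if "i < N" for i
    using that by (intro bdd_aboveI[of _ a]) (auto simp: P_def X_def)
  have upper: "y i \<le> z i" if "y \<in> P" "i < N" for y i
    unfolding z_def using bdd[OF that(2)] that(1) by (rule cSUP_upper2) simp
  have least: "z i \<le> C" if "\<And>y. y \<in> P \<Longrightarrow> y i \<le> C" for i C
    unfolding z_def using zero that by (intro cSUP_least) auto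
  have zX: "z \<in> X"
  proof -
    have "z i \<le> z j" if "i \<le> j" "j < N" for i j
    proof (rule least)
      fix y assume "y \<in> P"
      then have "y i \<le> y j"
        using that by (auto simp: P_def X_def monotone_on_def)
      then show "y i \<le> z j"
        using upper[OF \<open>y \<in> P\<close> \<open>j < N\<close>] by linarith
    qed
    moreover have "z i \<in> {0..a}" if "i < N" for i
      using upper[OF zero that] least[of i a] that by (auto simp: P_def X_def)
    ultimately show ?thesis by (auto simp: X_def monotone_on_def)
  qed
  have le: "z i \<le> \<Phi> z i" if "i < N" for i
  proof (rule least)
    fix y assume y: "y \<in> P"
    then have "y i \<le> \<Phi> y i" using that by (auto simp: P_def)
    also have "\<dots> \<le> \<Phi> z i"
      using y zX upper that by (intro \<Phi>_mono) (auto simp: P_def)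
    finally show "y i \<le> \<Phi> z i" .
  qed
  have "\<Phi> z \<in> P"
    using \<Phi>_X[OF zX] \<Phi>_mono[OF zX \<Phi>_X[OF zX] le] by (auto simp: P_def)
  then have fixed: "z i = \<Phi> z i" if "i < N" for i
    using le[OF that] upper[OF _ that, of "\<Phi> z"] by simp
  show ?thesis
  proof (rule that)
    show "mono_on {..<N} z" "\<And>i. i < N \<Longrightarrow> z i \<in> {0..a}"
      using zX by (auto simp: X_def)
    show "\<And>i. i + p < N \<Longrightarrow> z i = A (z (i + p))"
      using fixed by (simp add: \<Phi>_def)
    show "\<And>i. i < N \<Longrightarrow> N \<le> i + p \<Longrightarrow> z i = B (z (i + p - N))"
      using fixed by (simp add: \<Phi>_def)
  qed
qed

lemma mono_inverse_branch:
  fixes F :: "real \<Rightarrow> real"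
  assumes "u \<le> v" "continuous_on {u..v} F"
    and incr: "\<And>x y. u \<le> x \<Longrightarrow> x < y \<Longrightarrow> y \<le> v \<Longrightarrow> F x < F y"
  obtains A where "mono_on {F u..F v} A"
    and "\<And>y. y \<in> {F u..F v} \<Longrightarrow> A y \<in> {u..v} \<and> F (A y) = y"
proof -
  define A where "A y = (SOME x. x \<in> {u..v} \<and> F x = y)" for y
  have A: "A y \<in> {u..v} \<and> F (A y) = y" if "y \<in> {F u..F v}" for y
    unfolding A_def
    by (rule someI_ex) (use IVT'[of F u y v] assms that in auto)
  moreover have "mono_on {F u..F v} A"
  proof (rule mono_onI)
    fix x y assume xy: "x \<in> {F u..F v}" "y \<in> {F u..F v}" "x \<le> y"
    show "A x \<le> A y"
      using A[OF xy(1)] A[OF xy(2)] xy(3) incr[of "A y" "A x"] by fastforce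
  qed
  ultimately show ?thesis using that by blast
qed

context unimodal begin

text \<open>
  The branches are \<open>f\<close> on \<open>[0, b]\<close> and \<open>f \<circ> f\<close> on \<open>[c, a]\<close>, that is,
  \<open>[0, a]\<close> is mapped to itself by skipping the visits to the right. The second branch only
  attains values from \<open>f (f c)\<close> on; raising smaller targets to this value makes its inverse
  total. The resulting sequence is an orbit of \<open>f\<close> unless the raising takes place.
\<close>

lemma truncated_orbit:
  fixes p N :: nat
  assumes "p \<le> N"
  obtains z where "mono_on {..<N} z"
    and "\<And>i. i + p < N \<Longrightarrow> z i \<in> {0..b} \<and> f (z i) = z (i + p)"
    and "\<And>i. i < N \<Longrightarrow> N \<le> i + p \<Longrightarrow>
           z i \<in> {c..a} \<and> f (f (z i)) = max (f (f c)) (z (i + p - N))"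
proof -
  have contf: "continuous_on {0..b} f"
    using cont by (rule continuous_on_subset) (use order in auto)
  obtain A where A: "mono_on {f 0..f b} A"
      "\<And>y. y \<in> {f 0..f b} \<Longrightarrow> A y \<in> {0..b} \<and> f (A y) = y"
    by (rule mono_inverse_branch[OF _ contf]) (use order f_less in auto)
  have contff: "continuous_on {c..a} (\<lambda>x. f (f x))"
    using cont_ff by (rule continuous_on_subset) (use order in auto)
  obtain B' where B': "mono_on {f (f c)..f (f a)} B'"
      "\<And>y. y \<in> {f (f c)..f (f a)} \<Longrightarrow> B' y \<in> {c..a} \<and> f (f (B' y)) = y"
    by (rule mono_inverse_branch[OF _ contff]) (use order ff_less in auto)
  define B where "B y = B' (max (f (f c)) y)" for y
  have m: "f (f c) \<le> a" using ff_le[of c a] order fa by auto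
  have B: "B y \<in> {c..a} \<and> f (f (B y)) = max (f (f c)) y" if "y \<in> {0..a}" for y
    unfolding B_def using B'(2)[of "max (f (f c)) y"] m that fa by auto
  have "mono_on {0..a} B"
    unfolding B_def by (intro mono_onI mono_onD[OF B'(1)]) (use m fa in auto)
  moreover have "mono_on {0..a} A" using A(1) f0 fb by simp
  moreover have "A ` {0..a} \<subseteq> {0..b}" using A(2) f0 fb by auto
  moreover have "B ` {0..a} \<subseteq> {c..a}" using B by auto
  ultimately obtain z where z: "mono_on {..<N} z"
    "\<And>i. i < N \<Longrightarrow> z i \<in> {0..a}"
    "\<And>i. i + p < N \<Longrightarrow> z i = A (z (i + p))"
    "\<And>i. i < N \<Longrightarrow> N \<le> i + p \<Longrightarrow> z i = B (z (i + p - N))"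
    using monotone_branch_system_fixed_point[of b c a A B p N] order assms by (metis less_imp_le)
  show ?thesis
  proof (rule that[OF z(1)])
    fix i assume i: "i + p < N"
    show "z i \<in> {0..b} \<and> f (z i) = z (i + p)"
      using A(2)[of "z (i + p)"] z(2)[OF i] f0 fb unfolding z(3)[OF i] by auto
  next
    fix i assume i: "i < N" "N \<le> i + p"
    then have "i + p < N + N" using assms by linarith
    then have "i + p - N < N" using i by (simp add: less_diff_conv2)
    then show "z i \<in> {c..a} \<and> f (f (z i)) = max (f (f c)) (z (i + p - N))"
      using B[of "z (i + p - N)"] z(2)[of "i + p - N"] unfolding z(4)[OF i] by simp
  qed
qed

text \<open>
  Rotating \<open>N\<close> times by \<open>p\<close> leads back to the index 0 after winding around \<open>p\<close>
  times. Each winding is a visit to the right and costs one additional iterate of \<open>f\<close>,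
  so \<open>N + p\<close> is a period.
\<close>

lemma rotation_system_realizes:
  fixes p N :: nat
  assumes p: "0 < p" "p < N"
    and left: "\<And>i. i + p < N \<Longrightarrow> z i \<in> {0..b} \<and> f (z i) = z (i + p)"
    and right: "\<And>i. i < N \<Longrightarrow> N \<le> i + p \<Longrightarrow> z i \<in> {c..a} \<and> f (f (z i)) = z (i + p - N)"
  shows "real p / real (N + p) \<in> over_rotation_numbers {0..1} f"
proof -
  \<comment> \<open>If \<open>z i = a\<close>, then the index could be lowered by \<open>N - p\<close> again and again,
    always at the value \<open>a\<close>, until it is that of a point of \<open>[0, b]\<close>.\<close>
  have zless: "z i < a" if "i < N" for i
    using that
  proof (induction i rule: less_induct)
    case (less i)
    show ?case
    proof (cases "i + p < N")
      case True
      then show ?thesis using left[of i] order by auto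
    next
      case False
      then have "z (i + p - N) < a"
        using less p by auto
      moreover have "z i \<noteq> a"
      proof
        assume "z i = a"
        then have "z (i + p - N) = a"
          using right[of i] False less.prems fa by auto
        with \<open>z (i + p - N) < a\<close> show False by simp
      qed
      ultimately show ?thesis using right[of i] False less.prems by auto
    qed
  qed
  \<comment> \<open>After \<open>k\<close> steps of the rotation, \<open>w\<close> of which wind around, \<open>k + w\<close> iterates
    of \<open>f\<close> have been performed.\<close>
  have "\<exists>i w. i < N \<and> i + N * w = k * p \<and> (f ^^ (k + w)) (z 0) = z i
      \<and> right_visits f a (z 0) (k + w) = w" for k
  proof (induction k)
    case 0
    then show ?case using p by (intro exI[of _ 0]) auto
  next
    case (Suc k)
    then obtain i w where iw: "i < N" "i + N * w = k * p" "(f ^^ (k + w)) (z 0) = z i"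
      "right_visits f a (z 0) (k + w) = w" by auto
    show ?case
    proof (cases "i + p < N")
      case True
      then show ?thesis
        using iw left[OF True] order
        by (intro exI[of _ "i + p"] exI[of _ w]) (auto simp: algebra_simps)
    next
      case False
      have "a < f (z i)"
        using middle_to_right[of "z i"] right[of i] zless[of i] False iw(1) order by auto
      then show ?thesis
        using iw right[of i] zless[of i] False p
        by (intro exI[of _ "i + p - N"] exI[of _ "Suc w"]) (auto simp: algebra_simps)
    qed
  qed
  from this[of N] obtain i w where iw: "i < N" "i + N * w = N * p"
    "(f ^^ (N + w)) (z 0) = z i" "right_visits f a (z 0) (N + w) = w" by auto
  have "i = 0"
    using iw(1,2) by (metis dvd_add_left_iff dvd_triv_left nat_dvd_not_less neq0_conv)
  then have w: "w = p" using iw(1,2) by simp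
  have "f (z 0) \<noteq> z 0"
  proof
    assume "f (z 0) = z 0"
    then have "(f ^^ k) (z 0) = z 0" for k
      by (induction k) auto
    then have "right_visits f a (z 0) (N + w) = 0"
      using zless[of 0] p by (simp add: right_visits_def)
    then show False using iw(4) w p by simp
  qed
  moreover have "0 \<le> z 0" "z 0 \<le> 1"
    using left[of 0] p order by auto
  ultimately show ?thesis
    unfolding over_rotation_numbers_eq using iw \<open>i = 0\<close> w p
    by (auto intro!: exI[of _ "z 0"] exI[of _ "N + p"])
qed

text \<open>
  Since \<open>f (f b) = a > b\<close>, the map \<open>f \<circ> f\<close> has a fixed point between \<open>b\<close> and
  \<open>y\<close>, which yields an orbit of period two around \<open>a\<close>.
\<close>

lemma half_realized:
  assumes "c \<le> y" "y < a" "f (f y) \<le> y"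
  shows "1 / 2 \<in> over_rotation_numbers {0..1} f"
proof -
  have "continuous_on {b..y} (\<lambda>x. f (f x) - x)"
    by (intro continuous_intros continuous_on_subset[OF cont_ff]) (use order assms in auto)
  then obtain s where s: "b \<le> s" "s \<le> y" "f (f s) = s"
    using IVT2'[of "\<lambda>x. f (f x) - x" y 0 b] assms order fa fb by auto
  then have "b < s" using fa fb order by (cases "s = b") auto
  then have "a < f s" using middle_to_right[of s] s assms by auto
  then have "real (right_visits f a s 2) / real 2 = 1 / 2" "f s \<noteq> s"
    using s assms by (auto simp: numeral_2_eq_2)
  moreover have "0 \<le> s" "s \<le> 1" "(f ^^ 2) s = s"
    using s order assms by (auto simp: numeral_2_eq_2)
  ultimately show ?thesis
    unfolding over_rotation_numbers_eq mem_Collect_eq by (metis pos2)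
qed

end


section \<open>Comparing the orbits of two maps\<close>

text \<open>
  The coordinate change \<open>h\<close> transports the interval of \<open>g\<close> to that of \<open>f\<close>; in the
  common coordinate, the increasing branches of the induced map of \<open>f\<close> lie below those of
  \<open>g\<close>. A point of \<open>[0, 1]\<close> may be sent outside the unit interval by \<open>h\<close>, hence the guard
  \<open>0 \<le> h x\<close>.
\<close>

locale unimodal_comparison =
  F: unimodal f c a b + G: unimodal g c' a' b'
  for f :: "real \<Rightarrow> real" and c a b and g :: "real \<Rightarrow> real" and c' a' b' +
  fixes h :: "real \<Rightarrow> real"
  assumes h_mono: "strict_mono h" and hc: "h c' = c" and ha: "h a' = a"
    and left: "\<And>x. 0 < x \<Longrightarrow> x < b' \<Longrightarrow> 0 \<le> h x \<Longrightarrow> h x \<le> b \<and> f (h x) \<le> h (g x)"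
    and right: "\<And>x. c' \<le> x \<Longrightarrow> x \<le> a' \<Longrightarrow> f (f (h x)) \<le> h (g (g x))"
begin

lemma h_less_iff: "h x < h y \<longleftrightarrow> x < y" and h_le_iff: "h x \<le> h y \<longleftrightarrow> x \<le> y"
  using h_mono by (auto simp: strict_mono_less strict_mono_less_eq)

text \<open>
  Suppose that the rotation pattern of \<open>f\<close> is truncated. Then its points serve as
  barriers for \<open>g\<close>: since the branches of \<open>g\<close> lie above those of \<open>f\<close>, a point
  beyond the barrier \<open>z i\<close> is sent beyond the barrier \<open>z (i + p)\<close>, where an index
  that reaches \<open>N\<close> counts as one turn. The points of \<open>(b', c')\<close>, on which the
  induced map decreases, cause no trouble because their images are at least
  \<open>h\<^sup>-\<^sup>1 (f (f c))\<close>, which is beyond the lowest barrier. So every orbit of \<open>g\<close> turns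
  at least as fast as the pattern.
\<close>

lemma truncation_bounds_visits:
  fixes p N :: nat
  assumes p: "0 < p" "p < N"
    and sys_left: "\<And>i. i + p < N \<Longrightarrow> z i \<in> {0..b} \<and> f (z i) = z (i + p)"
    and sys_right: "\<And>i. i < N \<Longrightarrow> N \<le> i + p \<Longrightarrow>
           z i \<in> {c..a} \<and> f (f (z i)) = max (f (f c)) (z (i + p - N))"
    and low: "z 0 \<le> f (f c)"
    and y: "0 \<le> y" "y \<le> 1" "(g ^^ n) y = y" "0 < n" "g y \<noteq> y"
  shows "p * n \<le> (N + p) * right_visits g a' y n"
proof -
  obtain x where x: "0 < x" "x < a'" "(g ^^ n) x = x" "g x \<noteq> x"
    "right_visits g a' x n = right_visits g a' y n" "g (g c') \<le> x"
    using G.restart_after_right_visit[OF y] .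
  have x01: "0 \<le> x" "x \<le> 1" using x G.order by auto
  define W where "W = right_visits g a' x n"
  have m: "f (f c) \<le> h (g (g c'))"
    using right[of c'] hc G.order by simp
  \<comment> \<open>After \<open>k\<close> steps of the induced map with \<open>w\<close> visits to the right, the lifted index
    \<open>i + N * w\<close> of a barrier below the orbit has grown by at least \<open>p\<close> per step.\<close>
  have "\<exists>i w. i < N \<and> k * p \<le> i + N * w \<and> (g ^^ (k + w)) x < a'
      \<and> z i \<le> h ((g ^^ (k + w)) x) \<and> right_visits g a' x (k + w) = w" for k
  proof (induction k)
    case 0
    have "h (g (g c')) \<le> h x" using x by (simp add: h_le_iff)
    then show ?case using p x low m by (intro exI[of _ 0]) auto
  next
    case (Suc k)
    then obtain i w where iw: "i < N" "k * p \<le> i + N * w" "(g ^^ (k + w)) x < a'"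
      "z i \<le> h ((g ^^ (k + w)) x)" "right_visits g a' x (k + w) = w" by auto
    define u where "u = (g ^^ (k + w)) x"
    have u: "0 < u" "u \<noteq> b'" "u < a'"
      using iw(3) G.orbit_avoids_fixed_points[OF x01 x(3) y(4) x(4), of "k + w"]
        G.orbit_avoids_fixed_points(2)[OF x01 x(3) y(4) x(4), of "Suc (k + w)"]
        G.funpow_maps[OF x01, of "k + w"] G.fb by (auto simp: u_def)
    show ?case
    proof (cases "u < b'")
      case True
      \<comment> \<open>A point left of \<open>b'\<close> is below all barriers that lie in \<open>[c, a]\<close>.\<close>
      have iN: "i + p < N"
      proof (rule ccontr)
        assume "\<not> i + p < N"
        then have "c \<le> z i" using sys_right[of i] iw(1) by auto
        also have "z i \<le> h u" using iw(4) by (simp add: u_def)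
        also have "h u < c" using True G.order h_less_iff[of u c'] hc by auto
        finally show False by simp
      qed
      have "z i \<le> h u" using iw(4) by (simp add: u_def)
      then have "h u \<le> b" "f (h u) \<le> h (g u)"
        using left[of u] u True sys_left[OF iN] by auto
      moreover have "f (z i) \<le> f (h u)"
        using sys_left[OF iN] \<open>z i \<le> h u\<close> \<open>h u \<le> b\<close> F.order by (intro F.f_le) auto
      ultimately have "z (i + p) \<le> h (g u)" using sys_left[OF iN] by linarith
      moreover have "g u < a'" using G.left_of_b[of u] u True by auto
      ultimately show ?thesis
        using iw iN u
        by (intro exI[of _ "i + p"] exI[of _ w]) (auto simp: u_def algebra_simps)
    next
      case False
      then have gu: "a' < g u" "g u \<le> 1"
        using G.middle_to_right[of u] G.maps[of u] u G.order by auto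
      then have ggu: "g (g u) < a'" by (rule G.right_to_left)
      have mgu: "f (f c) \<le> h (g (g u))"
        using G.right_image_ge[of "g u" u] gu u G.order m h_le_iff[of "g (g c')" "g (g u)"] by auto
      have step: "Suc k * p \<le> j + N * Suc w \<Longrightarrow> j < N \<Longrightarrow> z j \<le> h (g (g u)) \<Longrightarrow> ?thesis" for j
        using iw u gu ggu
        by (intro exI[of _ j] exI[of _ "Suc w"]) (auto simp: u_def)
      show ?thesis
      proof (cases "i + p < N")
        case True
        show ?thesis
          by (rule step[of 0]) (use p iw True mgu low in auto)
      next
        case False
        have zi: "c \<le> z i" "z i \<le> a" "z i \<le> h u" "z (i + p - N) \<le> max (f (f c)) (z (i + p - N))"
          "f (f (z i)) = max (f (f c)) (z (i + p - N))"
          using sys_right[of i] iw(1,4) False by (auto simp: u_def)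
        have "c' \<le> u" using zi h_le_iff[of c' u] hc by auto
        have "h u \<le> a" using u h_le_iff[of u a'] ha by auto
        have "f (f (z i)) \<le> f (f (h u))"
          using zi \<open>h u \<le> a\<close> by (intro F.ff_le) auto
        also have "\<dots> \<le> h (g (g u))"
          using right[of u] \<open>c' \<le> u\<close> u by auto
        finally have "z (i + p - N) \<le> h (g (g u))" using zi by linarith
        then show ?thesis
          by (intro step[of "i + p - N"]) (use p iw False in auto)
      qed
    qed
  qed
  then have main: "\<exists>w. k * p \<le> N + N * w \<and> right_visits g a' x (k + w) = w" for k
    by (meson add_le_mono1 le_trans less_imp_le)
  have Wn: "2 * W \<le> n"
    using G.visits_le_half[OF x01 x(3)] by (simp add: W_def)
  \<comment> \<open>Eliminating \<open>w\<close> from the two estimates; as \<open>k\<close> is arbitrary, only the coefficient of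
    \<open>k\<close> matters.\<close>
  have bound: "real k * (real p * (real n - real W) - real N * real W) \<le> (real n - real W) * real N + real N * (real W * real n)" for k
  proof -
    obtain w where w: "k * p \<le> N + N * w" "right_visits g a' x (k + w) = w"
      using main by blast
    have "n * w \<le> W * (k + w + n)"
      using right_visits_le_proportion[OF x(3) y(4), of a' "k + w"] w by (simp add: W_def)
    then have "real n * real w \<le> real W * (real k + real w + real n)"
      by (metis of_nat_add of_nat_le_iff of_nat_mult)
    then have 1: "(real n - real W) * real w \<le> real W * real k + real W * real n"
      by (simp add: algebra_simps)
    have 2: "real k * real p \<le> real N + real N * real w"
      using w(1) by (metis of_nat_add of_nat_le_iff of_nat_mult)
    have "(real n - real W) * (real k * real p) \<le> (real n - real W) * (real N + real N * real w)"
      by (intro mult_left_mono 2) (use Wn in auto)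
    also have "\<dots> = (real n - real W) * real N + real N * ((real n - real W) * real w)"
      by (simp add: algebra_simps)
    also have "\<dots> \<le> (real n - real W) * real N + real N * (real W * real k + real W * real n)"
      by (intro add_left_mono mult_left_mono 1) auto
    finally have "real k * (real p * (real n - real W) - real N * real W)
        \<le> (real n - real W) * real N + real N * (real W * real n)"
      by (simp add: algebra_simps)
    then show ?thesis .
  qed
  have "real p * (real n - real W) - real N * real W \<le> 0"
  proof (rule ccontr)
    assume "\<not> ?thesis"
    then obtain k where "(real n - real W) * real N + real N * (real W * real n)
        < real k * (real p * (real n - real W) - real N * real W)"
      using reals_Archimedean3 by (metis not_le)
    then show False using bound[of k] by simp
  qed
  then have "real (p * n) \<le> real ((N + p) * W)"
    by (simp add: algebra_simps)
  then show ?thesis using x(5) unfolding W_def of_nat_le_iff by simp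
qed

text \<open>
  The pattern of rate \<open>p / (N + p)\<close> cannot be truncated, since the orbit of
  \<open>g\<close> would then have at least this rate. So the pattern is an orbit of \<open>f\<close>.
\<close>

lemma slower_rotation_realized:
  fixes p N :: nat
  assumes p: "0 < p" "p < N"
    and y: "0 \<le> y" "y \<le> 1" "(g ^^ n) y = y" "0 < n" "g y \<noteq> y"
    and less: "real (right_visits g a' y n) / real n < real p / real (N + p)"
  shows "real p / real (N + p) \<in> over_rotation_numbers {0..1} f"
proof -
  obtain z where z: "mono_on {..<N} z"
    "\<And>i. i + p < N \<Longrightarrow> z i \<in> {0..b} \<and> f (z i) = z (i + p)"
    "\<And>i. i < N \<Longrightarrow> N \<le> i + p \<Longrightarrow> z i \<in> {c..a} \<and> f (f (z i)) = max (f (f c)) (z (i + p - N))"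
    using F.truncated_orbit[of p N] p by auto
  have "\<not> p * n \<le> (N + p) * right_visits g a' y n"
    using less p y(4) by (simp add: field_simps flip: of_nat_mult of_nat_add)
  then have low: "f (f c) < z 0"
    using truncation_bounds_visits[OF p z(2,3) _ y] by fastforce
  show ?thesis
  proof (rule F.rotation_system_realizes[OF p, of z])
    fix i assume i: "i < N" "N \<le> i + p"
    then have "z 0 \<le> z (i + p - N)"
      using p by (intro mono_onD[OF z(1)]) auto
    then show "z i \<in> {c..a} \<and> f (f (z i)) = z (i + p - N)"
      using z(3)[OF i] low by auto
  qed (use z(2) in auto)
qed

text \<open>
  An orbit of rate one half alternates between the two sides of \<open>a'\<close>. If \<open>f\<close> had no orbit
  of period two, then \<open>f \<circ> f\<close> would move all points of \<open>[c, a)\<close> up, hence so would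
  \<open>g \<circ> g\<close>, and every second point of the orbit of \<open>g\<close> would form an increasing
  sequence.
\<close>

lemma half_preserved:
  assumes y: "0 \<le> y" "y \<le> 1" "(g ^^ n) y = y" "0 < n" "g y \<noteq> y"
    and half: "2 * right_visits g a' y n = n"
  shows "1 / 2 \<in> over_rotation_numbers {0..1} f"
proof (rule ccontr)
  assume no: "1 / 2 \<notin> over_rotation_numbers {0..1} f"
  have up: "y < f (f y)" if "c \<le> y" "y < a" for y
    using F.half_realized[OF that] no by fastforce
  obtain x where x: "0 < x" "x < a'" "(g ^^ n) x = x" "g x \<noteq> x"
    "right_visits g a' x n = right_visits g a' y n" "g (g c') \<le> x"
    using G.restart_after_right_visit[OF y] .
  have x01: "0 \<le> x" "x \<le> 1" using x G.order by auto
  have m: "c < h (g (g c'))"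
    using right[of c'] hc G.order up[of c] F.order by auto
  have inv: "(g ^^ (2 * k)) x < a' \<and> c \<le> h ((g ^^ (2 * k)) x) \<and>
      (g ^^ (2 * k)) x < (g ^^ (2 * Suc k)) x" for k
  proof -
    have right_next: "a' < g u" if "u = (g ^^ (2 * j)) x" "u < a'" for u j
    proof -
      have "(g ^^ (2 * j)) x = (g ^^ (2 * j mod n)) x"
        using x(3) by (simp add: funpow_mod_eq)
      then show ?thesis
        using G.alternating_if_half[OF x01 x(3), of "2 * j mod n"] half x(5) y(4) that by simp
    qed
    have step: "g (g u) < a' \<and> c \<le> h (g (g u)) \<and> u < g (g u)"
      if u: "u = (g ^^ (2 * j)) x" "u < a'" "c \<le> h u" for u j
    proof -
      have cu: "c' \<le> u" using u h_le_iff[of c' u] hc by auto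
      have gu: "a' < g u" "g u \<le> 1"
        using right_next[OF u(1,2)] G.maps[of u] cu u G.order by auto
      have "h u < a" using u h_less_iff[of u a'] ha by auto
      then have "h u < h (g (g u))" "u < g (g u)"
        using h_less_iff[of u "g (g u)"] up[of "h u"] right[of u] u cu by auto
      then show ?thesis
        using G.right_to_left[OF gu] u(3) by auto
    qed
    have "h (g (g c')) \<le> h x" using x by (simp add: h_le_iff)
    then have "(g ^^ (2 * k)) x < a' \<and> c \<le> h ((g ^^ (2 * k)) x)" for k
    proof (induction k)
      case 0
      then show ?case using x m by simp
    next
      case (Suc k)
      then show ?case using step[OF refl, of k] by simp
    qed
    then show ?thesis using step[OF refl, of k] by simp
  qed
  have "strict_mono (\<lambda>k. (g ^^ (2 * k)) x)"
    using inv by (simp add: strict_mono_Suc_iff)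
  then have "(g ^^ (2 * 0)) x < (g ^^ (2 * n)) x"
    using y(4) by (rule strict_monoD)
  then show False using funpow_mult_periodic[OF x(3), of 2] by simp
qed

text \<open>
  All rational rates between that of the given orbit of \<open>g\<close> and one half are attained
  by \<open>f\<close>. The rate itself is a limit of these.
\<close>

lemma over_rotation_interval_subset:
  "over_rotation_interval {0..1} g \<subseteq> over_rotation_interval {0..1} f"
  unfolding over_rotation_interval_def
proof (rule closure_minimal)
  show "over_rotation_numbers {0..1} g \<subseteq> closure (over_rotation_numbers {0..1} f)"
  proof
    fix r assume "r \<in> over_rotation_numbers {0..1} g"
    then obtain y n where r: "r = real (right_visits g a' y n) / real n"
      and y: "0 \<le> y" "y \<le> 1" "(g ^^ n) y = y" "0 < n" "g y \<noteq> y"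
      unfolding G.over_rotation_numbers_eq by auto
    have le: "2 * right_visits g a' y n \<le> n" by (rule G.visits_le_half) (use y in auto)
    show "r \<in> closure (over_rotation_numbers {0..1} f)"
    proof (cases "2 * right_visits g a' y n = n")
      case True
      then have "r = 1 / 2" unfolding r using y(4) by (simp add: field_simps)
      then show ?thesis
        using half_preserved[OF y True] closure_subset by blast
    next
      case False
      with le have "real (2 * right_visits g a' y n) < real n"
        unfolding of_nat_less_iff by simp
      then have r_half: "r < 1 / 2" and "0 \<le> r"
        unfolding r using y(4) by (auto simp: field_simps)
      show ?thesis
        unfolding closure_approachable
      proof (intro allI impI)
        fix e :: real assume "0 < e"
        then obtain q where q: "q \<in> \<rat>" "r < q" "q < min (1 / 2) (r + e)"
          using Rats_dense_in_real[of r "min (1 / 2) (r + e)"] r_half by auto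
        then have "q > 0" using \<open>0 \<le> r\<close> by simp
        then obtain p d :: nat where pd: "d \<noteq> 0" "q = real p / real d"
          using Rats_abs_nat_div_natE[OF q(1)] by (metis abs_of_pos)
        have p: "0 < p" "2 * p < d"
          using q \<open>q > 0\<close> pd by (auto simp: field_simps)
        have "q \<in> over_rotation_numbers {0..1} f"
          using slower_rotation_realized[of p "d - p" y n] p y q pd unfolding r by simp
        moreover have "dist q r < e" using q by (simp add: dist_real_def)
        ultimately show "\<exists>y\<in>over_rotation_numbers {0..1} f. dist y r < e" by blast
      qed
    qed
  qed
qed simp

end


section \<open>Members of the class\<close>

text \<open>
  The turning point, the fixed point and the twin are given by definite descriptions, which
  have to be shown to be well defined first.
\<close>

lemma peak_unique:
  assumes "is_peak f c" "is_peak f d"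
  shows "c = d"
proof -
  have False if "is_peak f c" "is_peak f d" "c < d" for c d
  proof -
    have "f c < f d" "f d < f c"
      using that by (auto simp: is_peak_def monotone_on_def)
    then show False by simp
  qed
  then show ?thesis using assms by (metis linorder_neqE_linordered_idom)
qed

lemma turning_pt_eq: "is_peak f c \<Longrightarrow> turning_pt f = c"
  unfolding turning_pt_def using peak_unique by blast

locale class_S_map =
  fixes f :: "real \<Rightarrow> real" and c :: real
  assumes in_S: "f \<in> class_S" and turning_pt: "turning_pt f = c"
begin

lemma peak_C1: "is_peak f c" "C1_on {0..c} f" "C1_on {c..1} f" "c < f c"
  using in_S turning_pt turning_pt_eq by (auto simp: class_S_def)

lemma c01: "0 < c" "c < 1"
  using peak_C1(1) by (auto simp: is_peak_def)

lemma ends [simp]: "f 0 = 0" "f 1 = 0"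
  using in_S by (auto simp: class_S_def)

lemma maps: "0 \<le> x \<Longrightarrow> x \<le> 1 \<Longrightarrow> 0 \<le> f x \<and> f x \<le> 1"
  using in_S by (fastforce simp: class_S_def image_subset_iff)

lemma concave: "concave_on {0..1} f"
  using in_S by (auto simp: class_S_def)

lemma increasing: "0 \<le> x \<Longrightarrow> x < y \<Longrightarrow> y \<le> c \<Longrightarrow> f x < f y"
  using peak_C1(1) by (auto simp: is_peak_def monotone_on_def)

lemma decreasing: "c \<le> x \<Longrightarrow> x < y \<Longrightarrow> y \<le> 1 \<Longrightarrow> f y < f x"
  using peak_C1(1) by (auto simp: is_peak_def monotone_on_def)

lemma cont: "continuous_on {0..1} f"
proof -
  have "continuous_on {0..c} f" "continuous_on {c..1} f"
    using peak_C1(2,3) unfolding C1_on_def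
    by (meson DERIV_continuous_on)+
  then have "continuous_on ({0..c} \<union> {c..1}) f"
    by (intro continuous_on_closed_Un) auto
  moreover have "{0..c} \<union> {c..1} = {0..1}" using c01 by auto
  ultimately show ?thesis by simp
qed

lemma deriv: "0 < x \<Longrightarrow> x < 1 \<Longrightarrow> x \<noteq> c \<Longrightarrow> (f has_real_derivative deriv01 f x) (at x)"
proof -
  assume x: "0 < x" "x < 1" "x \<noteq> c"
  have "\<exists>D. (f has_real_derivative D) (at x)"
  proof (cases "x < c")
    case True
    then obtain D where "(f has_real_derivative D) (at x within {0..c})"
      using peak_C1(2) x unfolding C1_on_def by (meson atLeastAtMost_iff less_imp_le)
    then show ?thesis using True x by (auto simp: at_within_Icc_at)
  next
    case False
    then obtain D where "(f has_real_derivative D) (at x within {c..1})"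
      using peak_C1(3) x unfolding C1_on_def by (meson atLeastAtMost_iff less_imp_le not_less)
    then show ?thesis using False x by (auto simp: at_within_Icc_at)
  qed
  then obtain D where D: "(f has_real_derivative D) (at x)" ..
  then have "vector_derivative f (at x) = D"
    by (intro vector_derivative_at) (simp add: has_real_derivative_iff_has_vector_derivative)
  then show ?thesis using D x by (simp add: at_within_Icc_at)
qed

text \<open>
  Concavity enters through the tangents: they give the monotonicity of the derivative and,
  together with strict monotonicity on either side of the peak, its strict signs.
\<close>

lemma tangent:
  assumes "0 < x" "x < 1" "x \<noteq> c" "0 \<le> y" "y \<le> 1"
  shows "f y \<le> f x + deriv01 f x * (y - x)"
proof -
  have "(\<lambda>x. - f x) y - (\<lambda>x. - f x) x \<ge> (- deriv01 f x) * (y - x)"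
  proof (rule convex_on_imp_above_tangent[of "{0..1}"])
    show "convex_on {0..1} (\<lambda>x. - f x)"
      using concave by (simp add: concave_on_def)
    show "((\<lambda>x. - f x) has_real_derivative - deriv01 f x) (at x within {0..1})"
      using DERIV_minus[OF deriv[OF assms(1-3)]] has_field_derivative_at_within by blast
  qed (use assms in auto)
  then show ?thesis by (simp add: algebra_simps)
qed

lemma deriv_antimono:
  assumes "0 < x" "x \<le> y" "y < 1" "x \<noteq> c" "y \<noteq> c"
  shows "deriv01 f y \<le> deriv01 f x"
proof (cases "x = y")
  case False
  have "f y \<le> f x + deriv01 f x * (y - x)" "f x \<le> f y + deriv01 f y * (x - y)"
    using tangent[of x y] tangent[of y x] assms by auto
  then have "deriv01 f y * (y - x) \<le> deriv01 f x * (y - x)"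
    by (simp add: algebra_simps)
  then show ?thesis using False assms by (simp add: mult_le_cancel_right)
qed simp

lemma deriv_pos: "0 < x \<Longrightarrow> x < c \<Longrightarrow> 0 < deriv01 f x"
  using tangent[of x c] increasing[of x c] c01
  by (smt (verit, best) mult_nonneg_nonneg mult_nonpos_nonneg)

lemma deriv_neg: "c < x \<Longrightarrow> x < 1 \<Longrightarrow> deriv01 f x < 0"
  using tangent[of x c] decreasing[of c x] c01
  by (smt (verit, best) mult_nonneg_nonpos)

lemma above_left: "0 < x \<Longrightarrow> x \<le> c \<Longrightarrow> x < f x"
proof -
  assume x: "0 < x" "x \<le> c"
  have "(1 - x / c) * f 0 + (x / c) * f c \<le> f ((1 - x / c) *\<^sub>R 0 + (x / c) *\<^sub>R c)"
    by (rule concave_onD[OF concave]) (use x c01 in auto)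
  then have "(x / c) * f c \<le> f x" using c01 by simp
  moreover have "(x / c) * c < (x / c) * f c"
    using peak_C1(4) x c01 by (intro mult_strict_left_mono) auto
  ultimately show ?thesis using c01 by simp
qed

lemma ex_fixed_pt: "\<exists>!a. a \<in> {turning_pt f<..1} \<and> f a = a"
proof (rule ex_ex1I)
  have "continuous_on {c..1} (\<lambda>x. f x - x)"
    by (intro continuous_intros continuous_on_subset[OF cont]) (use c01 in auto)
  then obtain x where x: "c \<le> x" "x \<le> 1" "f x = x"
    using IVT2'[of "\<lambda>x. f x - x" 1 0 c] peak_C1(4) c01 by auto
  then have "x \<noteq> c" using peak_C1(4) by auto
  then show "\<exists>a. a \<in> {turning_pt f<..1} \<and> f a = a"
    using x by (auto simp: turning_pt intro!: exI[of _ x])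
next
  fix x y assume *: "x \<in> {turning_pt f<..1} \<and> f x = x" "y \<in> {turning_pt f<..1} \<and> f y = y"
  then show "x = y"
    using decreasing[of x y] decreasing[of y x]
    by (cases x y rule: linorder_cases) (auto simp: turning_pt)
qed

lemma fixed_pt: "c < fixed_pt f" "fixed_pt f < 1" "f (fixed_pt f) = fixed_pt f"
proof -
  have *: "fixed_pt f \<in> {turning_pt f<..1} \<and> f (fixed_pt f) = fixed_pt f"
    unfolding fixed_pt_def by (rule theI'[OF ex_fixed_pt])
  moreover from this have "fixed_pt f \<noteq> 1" using ends(2) by (metis zero_neq_one)
  ultimately show "c < fixed_pt f" "fixed_pt f < 1" "f (fixed_pt f) = fixed_pt f"
    by (auto simp: turning_pt)
qed

lemma twin_eqI:
  assumes "c < x" "x \<le> 1" "0 \<le> y" "y \<le> c" "f y = f x"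
  shows "twin f x = y"
proof -
  have "z = y" if z: "z \<in> {0..1}" "z \<noteq> x" "f z = f x" for z
  proof (cases "z \<le> c")
    case True
    then have "\<not> y < z" "\<not> z < y"
      using increasing[of y z] increasing[of z y] assms(3-5) z by auto
    then show ?thesis by linarith
  next
    case False
    then have "\<not> x < z" "\<not> z < x"
      using decreasing[of x z] decreasing[of z x] assms(1,2) z by auto
    then show ?thesis using z(2) by linarith
  qed
  then have "(THE y. y \<in> {0..1} \<and> y \<noteq> x \<and> f y = f x) = y"
    using assms by (intro the_equality) auto
  then show ?thesis using assms by (simp add: twin_def turning_pt)
qed

lemma twin:
  assumes "c < x" "x < 1"
  shows "0 < twin f x" "twin f x < c" "f (twin f x) = f x"
proof -
  have fx: "0 < f x" "f x < f c"
    using decreasing[of x 1] decreasing[of c x] assms c01 by auto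
  have "continuous_on {0..c} f"
    using cont by (rule continuous_on_subset) (use c01 in auto)
  then obtain y where y: "0 \<le> y" "y \<le> c" "f y = f x"
    using IVT'[of f 0 "f x" c] fx c01 by auto
  then have "y \<noteq> 0" "y \<noteq> c" using fx by auto
  moreover have "twin f x = y" using twin_eqI y assms by auto
  ultimately show "0 < twin f x" "twin f x < c" "f (twin f x) = f x"
    using y by auto
qed

lemma is_unimodal: "unimodal f c (fixed_pt f) (twin f (fixed_pt f))"
proof
  show "strict_mono_on {0..c} f" "strict_antimono_on {c..1} f"
    using peak_C1(1) by (auto simp: is_peak_def)
  show "x < f x" if "0 < x" "x < fixed_pt f" for x
    using above_left[of x] decreasing[of x "fixed_pt f"] fixed_pt that by (cases "x \<le> c") auto
qed (use twin[OF fixed_pt(1,2)] fixed_pt maps cont in auto)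

end

sublocale class_S_map \<subseteq> unimodal f c "fixed_pt f" "twin f (fixed_pt f)"
  by (rule is_unimodal)

section \<open>Steeper maps have larger over-rotation intervals\<close>

locale steeper_pair = F: class_S_map f c + G: class_S_map g c for f g c +
  assumes steeper: "\<And>x. 0 < x \<Longrightarrow> x < 1 \<Longrightarrow> x \<noteq> c \<Longrightarrow> \<bar>deriv01 g x\<bar> \<le> \<bar>deriv01 f x\<bar>"
begin

lemma steeper_left: "0 < x \<Longrightarrow> x < c \<Longrightarrow> deriv01 g x \<le> deriv01 f x"
  using steeper[of x] F.deriv_pos[of x] G.deriv_pos[of x] F.c01 by auto

lemma steeper_right: "c < x \<Longrightarrow> x < 1 \<Longrightarrow> deriv01 f x \<le> deriv01 g x"
  using steeper[of x] F.deriv_neg[of x] G.deriv_neg[of x] F.c01 by auto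

text \<open>
  Both maps vanish at 1 and \<open>f\<close> decreases faster, so \<open>f\<close> is above \<open>g\<close> on the
  right.
\<close>

lemma fixed_pt_le: "fixed_pt g \<le> fixed_pt f"
proof -
  let ?a = "fixed_pt g"
  have "f 1 - g 1 \<le> f ?a - g ?a"
  proof (rule DERIV_nonpos_imp_decreasing_open[where f = "\<lambda>x. f x - g x"])
    show "continuous_on {?a..1} (\<lambda>x. f x - g x)"
      by (intro continuous_intros continuous_on_subset[OF F.cont] continuous_on_subset[OF G.cont])
        (use G.order in auto)
    fix x assume x: "?a < x" "x < 1"
    then have "((\<lambda>x. f x - g x) has_real_derivative deriv01 f x - deriv01 g x) (at x)"
      using G.order by (intro DERIV_diff F.deriv G.deriv) auto
    then show "\<exists>y. ((\<lambda>x. f x - g x) has_real_derivative y) (at x) \<and> y \<le> 0"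
      using steeper_right[of x] x G.order by fastforce
  qed (use G.order in auto)
  then have "?a \<le> f ?a" using G.fa by simp
  then show ?thesis using F.right_to_left[of ?a] F.order G.order by fastforce
qed

text \<open>
  The coordinate change is the dilation \<open>h\<close> about \<open>c\<close> that carries the fixed point of
  \<open>g\<close> to that of \<open>f\<close>. Its factor is at least 1 by \<open>fixed_pt_le\<close>, and by concavity
  slopes grow in absolute value with the distance from \<open>c\<close>; hence \<open>f\<close> seen in the
  coordinates of \<open>g\<close> is still steeper than \<open>g\<close>. The difference \<open>D\<close> is therefore
  monotone on each side of \<open>c\<close>. On the right it vanishes at the fixed point. On the left the
  hypothesis on the ratios says that \<open>h\<close> sends the twin for \<open>g\<close> to the left of the
  twin for \<open>f\<close>, so \<open>D\<close>, which increases there, is nonpositive up to the twin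
  for \<open>g\<close>.
\<close>

lemma over_rotation_interval_subset_if_ratio:
  assumes ratio: "(fixed_pt g - c) / (c - twin g (fixed_pt g))
     \<le> (fixed_pt f - c) / (c - twin f (fixed_pt f))"
  shows "over_rotation_interval {0..1} g \<subseteq> over_rotation_interval {0..1} f"
proof -
  define \<kappa> where "\<kappa> = (fixed_pt f - c) / (fixed_pt g - c)"
  define h where "h x = c + \<kappa> * (x - c)" for x
  have \<kappa>: "1 \<le> \<kappa>" using fixed_pt_le G.order by (simp add: \<kappa>_def)
  have h_mono: "strict_mono h" using \<kappa> by (auto simp: strict_mono_def h_def)
  have hc: "h c = c" by (simp add: h_def)
  have ha: "h (fixed_pt g) = fixed_pt f" using G.order by (simp add: h_def \<kappa>_def)
  have hb: "h (twin g (fixed_pt g)) \<le> twin f (fixed_pt f)"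
  proof -
    have "(fixed_pt g - c) * (c - twin f (fixed_pt f)) \<le> (fixed_pt f - c) * (c - twin g (fixed_pt g))"
      using ratio F.order G.order by (simp add: field_simps)
    then have "c - twin f (fixed_pt f) \<le> \<kappa> * (c - twin g (fixed_pt g))"
      using G.order by (simp add: \<kappa>_def field_simps)
    then show ?thesis by (simp add: h_def algebra_simps)
  qed
  have h_le: "h x \<le> h y \<longleftrightarrow> x \<le> y" and h_less: "h x < h y \<longleftrightarrow> x < y" for x y
    using h_mono by (auto simp: strict_mono_less strict_mono_less_eq)
  have h_right: "x \<le> h x" if "c \<le> x" for x
    using mult_right_mono[OF \<kappa>, of "x - c"] that by (simp add: h_def)
  have h_left: "h x \<le> x" if "x \<le> c" for x
    using mult_right_mono_neg[OF \<kappa>, of "x - c"] that by (simp add: h_def)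
  define D where "D x = f (h x) - h (g x)" for x
  have conth: "continuous_on S h" for S
    unfolding h_def by (intro continuous_intros)
  have contD: "continuous_on {u..v} D" if "0 \<le> u" "0 \<le> h u" "v \<le> 1" "h v \<le> 1" for u v
  proof -
    have "continuous_on {u..v} (\<lambda>x. f (h x))"
    proof (rule continuous_on_compose2[OF F.cont conth], rule image_subsetI)
      fix x assume "x \<in> {u..v}"
      then have "h u \<le> h x" "h x \<le> h v" by (simp_all add: h_le)
      then show "h x \<in> {0..1}" using that by simp
    qed
    moreover have "continuous_on {u..v} (\<lambda>x. h (g x))"
      by (rule continuous_on_compose2[OF conth[of UNIV] continuous_on_subset[OF G.cont]])
        (use that in auto)
    ultimately show ?thesis unfolding D_def by (intro continuous_intros)
  qed
  have derD: "(D has_real_derivative \<kappa> * (deriv01 f (h x) - deriv01 g x)) (at x)"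
    if "0 < x" "x < 1" "0 < h x" "h x < 1" "x \<noteq> c" for x
  proof -
    have "h x \<noteq> c" using that(5) \<kappa> by (simp add: h_def)
    have dh: "(h has_real_derivative \<kappa>) (at y)" for y
      unfolding h_def by (auto intro!: derivative_eq_intros)
    have "((\<lambda>x. f (h x)) has_real_derivative deriv01 f (h x) * \<kappa>) (at x)"
      by (rule DERIV_chain2[OF F.deriv dh]) (use that \<open>h x \<noteq> c\<close> in auto)
    moreover have "((\<lambda>x. h (g x)) has_real_derivative \<kappa> * deriv01 g x) (at x)"
      by (rule DERIV_chain2[OF dh G.deriv]) (use that in auto)
    ultimately show ?thesis
      unfolding D_def by (auto intro!: derivative_eq_intros simp: algebra_simps)
  qed
  have D_right: "D v \<le> D u" if "c \<le> u" "u \<le> v" "h v \<le> 1" for u v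
  proof (rule DERIV_nonpos_imp_decreasing_open[OF that(2)])
    have "v \<le> 1" using h_right[of v] that by simp
    moreover have "0 \<le> h u" using h_right[of u] that F.c01 by simp
    ultimately show "continuous_on {u..v} D" using that F.c01 by (intro contD) auto
    fix x assume x: "u < x" "x < v"
    then have hx: "h x < 1" "x \<le> h x" "c < x" using h_less[of x v] h_right[of x] that by auto
    have "deriv01 f (h x) \<le> deriv01 f x"
      using hx F.c01 by (intro F.deriv_antimono) auto
    also have "\<dots> \<le> deriv01 g x" using steeper_right hx by auto
    finally have "\<kappa> * (deriv01 f (h x) - deriv01 g x) \<le> 0"
      using \<kappa> by (intro mult_nonneg_nonpos) auto
    then show "\<exists>y. (D has_real_derivative y) (at x) \<and> y \<le> 0"
      using derD[of x] hx F.c01 by (auto intro!: exI)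
  qed
  have D_left: "D u \<le> D v" if "0 \<le> h u" "u \<le> v" "v \<le> c" for u v
  proof (rule DERIV_nonneg_imp_increasing_open[OF that(2)])
    have "0 \<le> u" using h_left[of u] that by simp
    moreover have "h v \<le> 1" using h_left[of v] that F.c01 by simp
    ultimately show "continuous_on {u..v} D" using that F.c01 by (intro contD) auto
    fix x assume x: "u < x" "x < v"
    then have hx: "0 < h x" "h x \<le> x" "x < c" using h_less[of u x] h_left[of x] that by auto
    have "deriv01 g x \<le> deriv01 f x" using steeper_left hx by auto
    also have "\<dots> \<le> deriv01 f (h x)"
      using hx F.c01 by (intro F.deriv_antimono) auto
    finally have "\<kappa> * (deriv01 f (h x) - deriv01 g x) \<ge> 0"
      using \<kappa> by (intro mult_nonneg_nonneg) auto
    then show "\<exists>y. (D has_real_derivative y) (at x) \<and> y \<ge> 0"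
      using derD[of x] hx F.c01 by (auto intro!: exI)
  qed
  have Da: "D (fixed_pt g) = 0" by (simp add: D_def ha F.fa G.fa)
  interpret unimodal_comparison f c "fixed_pt f" "twin f (fixed_pt f)"
    g c "fixed_pt g" "twin g (fixed_pt g)" h
  proof
    show "strict_mono h" "h c = c" "h (fixed_pt g) = fixed_pt f" by fact+
  next
    fix x assume x: "0 < x" "x < twin g (fixed_pt g)" "0 \<le> h x"
    let ?b = "twin g (fixed_pt g)"
    have "f (h ?b) \<le> fixed_pt f"
      using F.f_le[of "h ?b" "twin f (fixed_pt f)"] hb h_le[of x ?b] x F.fb F.order by auto
    then have "D ?b \<le> 0" by (simp add: D_def ha G.fb)
    moreover have "D x \<le> D ?b" using x G.order by (intro D_left) auto
    ultimately show "h x \<le> twin f (fixed_pt f) \<and> f (h x) \<le> h (g x)"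
      using hb h_le[of x ?b] x by (auto simp: D_def)
  next
    fix x assume x: "c \<le> x" "x \<le> fixed_pt g"
    have "h x \<le> fixed_pt f" using h_le x ha by metis
    have "D (fixed_pt g) \<le> D x" using x ha F.order by (intro D_right) auto
    then have 1: "h (g x) \<le> f (h x)" using Da by (simp add: D_def)
    moreover have "f (h x) \<le> 1"
      using F.maps[of "h x"] h_right[of x] x \<open>h x \<le> fixed_pt f\<close> F.order by auto
    ultimately have "h (g x) \<le> 1" by simp
    have gx: "fixed_pt g \<le> g x" using G.f_ge[of x "fixed_pt g"] x G.fa G.order by auto
    then have "D (g x) \<le> 0" using D_right[of "fixed_pt g" "g x"] Da \<open>h (g x) \<le> 1\<close> G.order by auto
    then have "f (h (g x)) \<le> h (g (g x))" by (simp add: D_def)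
    moreover have "f (f (h x)) \<le> f (h (g x))"
      using F.f_ge[of "h (g x)" "f (h x)"] 1 \<open>f (h x) \<le> 1\<close> h_right[of "g x"] gx G.order by auto
    ultimately show "f (f (h x)) \<le> h (g (g x))" by simp
  qed
  show ?thesis by (rule over_rotation_interval_subset)
qed

end

section \<open>Multiples of a map\<close>

context class_S_map begin

text \<open>
  The derivative of the twin is \<open>f' x / f' (twin f x)\<close>, so the hypothesis on the
  slopes says that the derivative of the ratio is nonnegative.
\<close>

lemma twin_ratio_mono:
  assumes slopes: "\<And>x. c < x \<Longrightarrow> x < 1 \<Longrightarrow>
      \<bar>deriv01 f x * (x - c)\<bar> \<le> \<bar>deriv01 f (twin f x) * (twin f x - c)\<bar>"
    and uv: "c < u" "u \<le> v" "v < 1"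
  shows "(u - c) / (c - twin f u) \<le> (v - c) / (c - twin f v)"
proof (rule DERIV_nonneg_imp_nondecreasing[OF uv(2)])
  fix x assume "u \<le> x" "x \<le> v"
  then have x: "c < x" "x < 1" using uv by auto
  \<comment> \<open>\<open>k\<close> is the inverse of the increasing branch, so that the twin is \<open>k \<circ> f\<close>.\<close>
  obtain k where k: "\<And>y. y \<in> {0..c} \<Longrightarrow> k (f y) = y"
    using the_inv_into_f_f[of f "{0..c}"] strict_mono_on_imp_inj_on[OF incr] by blast
  have twin_k: "twin f y = k (f y)" if "c < y" "y < 1" for y
    using k[of "twin f y"] twin[OF that] by auto
  have img: "f ` {0..c} = {0..f c}"
  proof (intro equalityI subsetI)
    fix y assume "y \<in> {0..f c}"
    moreover have "continuous_on {0..c} f"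
      using cont by (rule continuous_on_subset) (use c01 in auto)
    ultimately show "y \<in> f ` {0..c}"
      using IVT'[of f 0 y c] c01 by auto
  qed (use maps f_le[of _ c] c01 in auto)
  have "continuous_on (f ` {0..c}) k"
    by (rule continuous_on_inv) (use k c01 in \<open>auto intro: continuous_on_subset[OF cont]\<close>)
  then have contk: "continuous_on {0..f c} k" by (simp add: img)
  have fx: "0 < f x" "f x < f c"
    using decreasing[of x 1] decreasing[of c x] x c01 by auto
  let ?t = "twin f x"
  have t: "0 < ?t" "?t < c" "f ?t = f x" using twin[OF x] .
  have "isCont k (f x)"
    using continuous_on_interior[OF contk, of "f x"] fx by simp
  then have dk: "(k has_real_derivative inverse (deriv01 f ?t)) (at (f x))"
  proof (intro DERIV_inverse_function[where f = f and a = 0 and b = "f c"])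
    fix y assume "0 < y" "y < f c"
    then have "y \<in> f ` {0..c}" by (simp add: img)
    then show "f (k y) = y" using k by auto
  qed (use deriv[of ?t] deriv_pos[of ?t] t c01 fx twin_k[OF x] in auto)
  have "((\<lambda>y. k (f y)) has_real_derivative inverse (deriv01 f ?t) * deriv01 f x) (at x)"
    by (rule DERIV_chain2[OF dk deriv]) (use x c01 in auto)
  then have dtwin: "(twin f has_real_derivative inverse (deriv01 f ?t) * deriv01 f x) (at x)"
    by (rule DERIV_cong_ev[THEN iffD1, OF refl _ refl, rotated])
      (use twin_k x in \<open>auto intro!: eventually_mono[OF eventually_nhds_in_open[of "{c<..<1}"]]\<close>)
  define T where "T = inverse (deriv01 f ?t) * deriv01 f x"
  have "((\<lambda>y. (y - c) / (c - twin f y)) has_real_derivative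
      (1 * (c - ?t) - (x - c) * (0 - T)) / ((c - ?t) * (c - ?t))) (at x)"
    using t by (auto intro!: derivative_eq_intros dtwin[folded T_def])
  moreover have "0 \<le> 1 * (c - ?t) - (x - c) * (0 - T)"
  proof -
    have "- deriv01 f x * (x - c) \<le> deriv01 f ?t * (c - ?t)"
      using slopes[OF x] deriv_pos[of ?t] deriv_neg[of x] t x
      by (simp add: abs_mult)
    then have "- deriv01 f x * (x - c) / deriv01 f ?t \<le> c - ?t"
      using deriv_pos[of ?t] t by (simp add: field_simps)
    moreover have "(x - c) * (0 - T) = - deriv01 f x * (x - c) / deriv01 f ?t"
      by (simp add: T_def divide_inverse)
    ultimately show ?thesis by simp
  qed
  ultimately show "\<exists>D. ((\<lambda>y. (y - c) / (c - twin f y)) has_real_derivative D) (at x) \<and> 0 \<le> D"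
    by (meson divide_nonneg_nonneg zero_le_square)
qed

lemma scale_is_peak:
  assumes "0 < \<nu>"
  shows "is_peak (\<lambda>x. \<nu> * f x) c"
  using peak_C1(1) assms by (auto simp: is_peak_def monotone_on_def)

lemma scale_class_S_map:
  assumes "1 \<le> \<nu>" and into: "(\<lambda>x. \<nu> * f x) ` {0..1} \<subseteq> {0..1}"
  shows "class_S_map (\<lambda>x. \<nu> * f x) c"
proof
  have C1: "C1_on A (\<lambda>x. \<nu> * f x)" if C: "C1_on A f" for A
  proof -
    obtain D where D: "continuous_on A D \<and>
        (\<forall>x\<in>A. (f has_real_derivative D x) (at x within A))"
      using C unfolding C1_on_def ..
    then show ?thesis
      unfolding C1_on_def
      by (intro exI[of _ "\<lambda>x. \<nu> * D x"] conjI ballI continuous_on_mult_left DERIV_cmult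
          conjunct1[OF D] conjunct2[OF D, rule_format])
  qed
  have "1 * f c \<le> \<nu> * f c"
    by (rule mult_right_mono) (use assms(1) peak_C1(4) c01 in auto)
  then have "c < \<nu> * f c"
    using peak_C1(4) by linarith
  moreover have "concave_on {0..1} (\<lambda>x. \<nu> * f x)"
    using concave_on_cmul[OF _ concave, of \<nu>] assms(1) by simp
  ultimately show "(\<lambda>x. \<nu> * f x) \<in> class_S"
    unfolding class_S_def mem_Collect_eq ends
    by (intro conjI exI[of _ c] into scale_is_peak C1 peak_C1) (use assms(1) in simp_all)
  show "turning_pt (\<lambda>x. \<nu> * f x) = c"
    by (intro turning_pt_eq scale_is_peak) (use assms(1) in simp)
qed

lemma deriv_scale:
  assumes "0 < x" "x < 1" "x \<noteq> c"
  shows "deriv01 (\<lambda>x. \<nu> * f x) x = \<nu> * deriv01 f x"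
proof -
  have "((\<lambda>x. \<nu> * f x) has_vector_derivative \<nu> * deriv01 f x) (at x)"
    using DERIV_cmult[OF deriv[OF assms]] by (simp add: has_real_derivative_iff_has_vector_derivative)
  then show ?thesis
    using assms vector_derivative_at by (fastforce simp: at_within_Icc_at)
qed

end

theorem lemma3p2:
  "(\<forall>f\<in>class_S. \<forall>g\<in>class_S. \<forall>c::real.
      turning_pt f = c \<and> turning_pt g = c \<and>
      (\<forall>x\<in>{0..1}. x \<noteq> c \<longrightarrow> \<bar>deriv01 f x\<bar> \<ge> \<bar>deriv01 g x\<bar>) \<and>
      \<bar>c - fixed_pt f\<bar> / \<bar>c - twin f (fixed_pt f)\<bar> \<ge> \<bar>c - fixed_pt g\<bar> / \<bar>c - twin g (fixed_pt g)\<bar>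
      \<longrightarrow> over_rotation_interval {0..1} f \<supseteq> over_rotation_interval {0..1} g)
   \<and>
   (\<forall>g\<in>class_S.
      (\<forall>x\<in>{turning_pt g..1}.
         \<bar>deriv01 g x * (x - turning_pt g)\<bar> \<le> \<bar>deriv01 g (twin g x) * (twin g x - turning_pt g)\<bar>)
      \<longrightarrow> (\<forall>\<nu>::real. \<nu> > 1 \<and> (\<lambda>x. \<nu> * g x) ` {0..1} \<subseteq> {0..1}
             \<longrightarrow> over_rotation_interval {0..1} (\<lambda>x. \<nu> * g x) \<supseteq> over_rotation_interval {0..1} g))"
proof (intro conjI ballI allI impI)
  fix f g c
  assume "f \<in> class_S" "g \<in> class_S"
    and *: "turning_pt f = c \<and> turning_pt g = c \<and>
      (\<forall>x\<in>{0..1}. x \<noteq> c \<longrightarrow> \<bar>deriv01 f x\<bar> \<ge> \<bar>deriv01 g x\<bar>) \<and>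
      \<bar>c - fixed_pt f\<bar> / \<bar>c - twin f (fixed_pt f)\<bar> \<ge> \<bar>c - fixed_pt g\<bar> / \<bar>c - twin g (fixed_pt g)\<bar>"
  then interpret steeper_pair f g c by unfold_locales auto
  have "(fixed_pt g - c) / (c - twin g (fixed_pt g)) \<le> (fixed_pt f - c) / (c - twin f (fixed_pt f))"
    using * F.order G.order by (simp add: abs_if)
  then show "over_rotation_interval {0..1} g \<subseteq> over_rotation_interval {0..1} f"
    by (rule over_rotation_interval_subset_if_ratio)
next
  fix g :: "real \<Rightarrow> real" and \<nu> :: real
  assume "g \<in> class_S"
    and slopes: "\<forall>x\<in>{turning_pt g..1}.
         \<bar>deriv01 g x * (x - turning_pt g)\<bar> \<le> \<bar>deriv01 g (twin g x) * (twin g x - turning_pt g)\<bar>"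
    and \<nu>: "\<nu> > 1 \<and> (\<lambda>x. \<nu> * g x) ` {0..1} \<subseteq> {0..1}"
  define c where "c = turning_pt g"
  interpret G: class_S_map g c
    using \<open>g \<in> class_S\<close> by unfold_locales (auto simp: c_def)
  interpret F: class_S_map "\<lambda>x. \<nu> * g x" c
    using \<nu> by (intro G.scale_class_S_map) auto
  interpret steeper_pair "\<lambda>x. \<nu> * g x" g c
  proof
    fix x :: real assume x: "0 < x" "x < 1" "x \<noteq> c"
    have "1 * \<bar>deriv01 g x\<bar> \<le> \<nu> * \<bar>deriv01 g x\<bar>"
      using \<nu> by (intro mult_right_mono) auto
    then show "\<bar>deriv01 g x\<bar> \<le> \<bar>deriv01 (\<lambda>x. \<nu> * g x) x\<bar>"
      using \<nu> by (simp add: G.deriv_scale[OF x] abs_mult)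
  qed
  let ?a = "fixed_pt (\<lambda>x. \<nu> * g x)"
  have "(fixed_pt g - c) / (c - twin g (fixed_pt g)) \<le> (?a - c) / (c - twin g ?a)"
    using slopes fixed_pt_le G.order F.order
    by (intro G.twin_ratio_mono) (auto simp: c_def)
  moreover have "twin g ?a = twin (\<lambda>x. \<nu> * g x) ?a"
    using F.twin[of ?a] F.order \<nu> by (intro G.twin_eqI) auto
  ultimately show "over_rotation_interval {0..1} g \<subseteq> over_rotation_interval {0..1} (\<lambda>x. \<nu> * g x)"
    by (intro over_rotation_interval_subset_if_ratio) simp
qed

end
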